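(* Let $p\ge1$, $I=\{1,\dots,p\}$, and for each $i\in I$ let $g_i:\mathbb{R}^n\to\mathbb{R}$ be a $\mathcal{C}^3$ concave function. Assume that there exists $x^0\in\mathbb{R}^n$ with $g_i(x^0)>0$ for all $i\in I$, and set $$C=\{x\in\mathbb{R}^n\mid g_i(x)>0,\ i\in I\}.$$ Let $\theta\in\Gamma_0(\mathbb{R})$ be a convex function of Legendre type such that: (i) $(0,\infty)\subset\operatorname{dom}\theta\subset[0,\infty)$; (ii) $\theta\in\mathcal{C}^3(0,\infty)$ and $\lim_{s\to0^+}\theta'(s)=-\infty$; (iii) $\theta''(s)>0$ for all $s>0$; (iv) either $\theta$ is non-increasing or $g_i$ is an affine function for every $i\in I$. Then the function $h\in\Gamma_0(\mathbb{R}^n)$ defined by $$h(x)=\sum_{i\in I}\theta(g_i(x))$$ is essentially smooth with $\operatorname{int}\operatorname{dom}h=C$ and $h\in\mathcal{C}^3(C)$. If in addition $$\operatorname{span}\{\nabla g_i(x)\mid i\in I\}=\mathbb{R}^n\quad\text{for all }x\in C,$$ then $H=\nabla^2h$ is positive definite on $C$, and consequently: $h$ is of Legendre type with $\operatorname{int}\operatorname{dom}h=C$; $h_{|C}\in\mathcal{C}^2(C;\mathbb{R})$ with $\nabla^2h(x)$ symmetric positive definite for all $x\in C$; and $x\mapsto\nabla^2h(x)$ is locally Lipschitz continuous on $C$.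
   Context: $\Gamma_0(\mathbb{R}^n)$ is the set of lower semicontinuous proper convex functions $\mathbb{R}^n\to\mathbb{R}\cup\{+\infty\}$, and $\operatorname{dom}g=\{x\mid g(x)<+\infty\}$. A function $g\in\Gamma_0(\mathbb{R}^n)$ is essentially smooth if it is differentiable on $\operatorname{int}\operatorname{dom}g$ and $|\nabla g(x^j)|\to+\infty$ for every sequence $(x^j)\subset\operatorname{int}\operatorname{dom}g$ converging to a boundary point of $\operatorname{dom}g$; it is of Legendre type if moreover it is strictly convex on $\operatorname{int}\operatorname{dom}g$. *)

theory Defs
  imports "HOL-Analysis.Analysis"
begin

definition eff_dom :: "('a \<Rightarrow> ereal) \<Rightarrow> 'a set" where
  "eff_dom g = {x. g x < \<infinity>}"

text \<open>The class $\Gamma_0$: proper (the first two conjuncts), lower semicontinuous, convex.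
  As the value \<open>-\<infinity>\<close> is excluded, the right-hand side of the convexity inequality is
  never of the form \<open>\<infinity> - \<infinity>\<close>.\<close>

definition Gamma0 :: "('a::euclidean_space \<Rightarrow> ereal) set" where
  "Gamma0 = {g. (\<forall>x. g x \<noteq> -\<infinity>) \<and> eff_dom g \<noteq> {} \<and>
                (\<forall>x. g x \<le> Liminf (at x) g) \<and>
                (\<forall>x y. \<forall>t\<in>{0<..<1}.
                   g ((1 - t) *\<^sub>R x + t *\<^sub>R y) \<le> ereal (1 - t) * g x + ereal t * g y)}"

definition strictly_convex_on :: "'a::real_vector set \<Rightarrow> ('a \<Rightarrow> real) \<Rightarrow> bool" where
  "strictly_convex_on S f \<longleftrightarrow> convex S \<and>
     (\<forall>x\<in>S. \<forall>y\<in>S. x \<noteq> y \<longrightarrow> (\<forall>t\<in>{0<..<1}.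
        f ((1 - t) *\<^sub>R x + t *\<^sub>R y) < (1 - t) * f x + t * f y))"

text \<open>The gradient and the Hessian are only meaningful where \<open>f\<close> is differentiable,
  respectively where its gradient is.\<close>

definition grad :: "('a::euclidean_space \<Rightarrow> real) \<Rightarrow> 'a \<Rightarrow> 'a" where
  "grad f x = (THE D. GDERIV f x :> D)"

definition hessian :: "(real ^ 'n \<Rightarrow> real) \<Rightarrow> real ^ 'n \<Rightarrow> real ^ 'n ^ 'n" where
  "hessian f x = jacobian (grad f) (at x)"

definition pos_definite :: "real ^ 'n ^ 'n \<Rightarrow> bool" where
  "pos_definite A \<longleftrightarrow> (\<forall>v. v \<noteq> 0 \<longrightarrow> 0 < v \<bullet> (A *v v))"

text \<open>\<open>C_on k S f\<close> says that \<open>f\<close> is of class $C^k$ on the open set \<open>S\<close>. The higher derivatives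
  are expressed through the directional derivatives \<open>x \<mapsto> Df(x) v\<close> for fixed \<open>v\<close>, since the
  iterated Frechet derivatives have types depending on \<open>k\<close>; in finite dimension
  \<open>x \<mapsto> Df(x)\<close> is of class $C^{k-1}$ iff all of these are.\<close>

primrec C_on :: "nat \<Rightarrow> 'a::euclidean_space set \<Rightarrow> ('a \<Rightarrow> real) \<Rightarrow> bool" where
  "C_on 0 S f \<longleftrightarrow> continuous_on S f"
| "C_on (Suc k) S f \<longleftrightarrow>
     (\<forall>x\<in>S. f differentiable at x) \<and> (\<forall>v. C_on k S (\<lambda>x. frechet_derivative f (at x) v))"

text \<open>An extended-real-valued function is differentiated on the interior of its effective domain,
  where it is finite, via \<open>real_of_ereal\<close>.\<close>

definition essentially_smooth :: "('a::euclidean_space \<Rightarrow> ereal) \<Rightarrow> bool" where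
  "essentially_smooth g \<longleftrightarrow> g \<in> Gamma0 \<and>
     (\<lambda>x. real_of_ereal (g x)) differentiable_on interior (eff_dom g) \<and>
     (\<forall>X l. (\<forall>j. X j \<in> interior (eff_dom g)) \<and> l \<in> frontier (eff_dom g) \<and> X \<longlonglongrightarrow> l \<longrightarrow>
        filterlim (\<lambda>j. norm (grad (\<lambda>x. real_of_ereal (g x)) (X j))) at_top sequentially)"

definition legendre_type :: "('a::euclidean_space \<Rightarrow> ereal) \<Rightarrow> bool" where
  "legendre_type g \<longleftrightarrow> essentially_smooth g \<and>
     strictly_convex_on (interior (eff_dom g)) (\<lambda>x. real_of_ereal (g x))"

text \<open>The library notion concerns families indexed by a parameter; here there is none.\<close>

abbreviation locally_lipschitz_on ::
    "'a::metric_space set \<Rightarrow> ('a \<Rightarrow> 'b::metric_space) \<Rightarrow> bool" where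
  "locally_lipschitz_on S f \<equiv> local_lipschitz {0::real} S (\<lambda>_. f)"

end

theory Submission
  imports Defs
begin

text \<open>Everything takes place on the open convex set \<open>C\<close>, where \<open>h = (\<Sum>i\<in>I. \<theta> (g i x))\<close> is finite. If
  \<open>X j \<rightarrow> l\<close> with \<open>l\<close> on the boundary, some \<open>g k\<close> vanishes at \<open>l\<close>. Test the gradient against
  \<open>x0 - X j\<close>: by concavity \<open>\<nabla>(g k)(X j) \<bullet> (x0 - X j) \<ge> g k x0 - g k (X j)\<close>, which stays away from
  \<open>0\<close>, so the factor \<open>\<theta>'(g k (X j)) \<rightarrow> -\<infinity>\<close> drives the inner product to \<open>-\<infinity>\<close>; the indices with
  \<open>g i l > 0\<close> contribute bounded terms. Hence the norm of the gradient blows up.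

  The second derivative of \<open>h\<close> in direction \<open>v\<close> is
  \<open>\<Sum>i\<in>I. \<theta>''(g i x) (\<nabla>(g i)(x) \<bullet> v)\<^sup>2 + \<theta>'(g i x) D\<^sup>2(g i)(x)(v, v)\<close>. The second summands are
  nonnegative because \<open>\<theta>' \<le> 0\<close> and \<open>g i\<close> is concave, or because \<open>g i\<close> is affine; the first ones
  cannot all vanish when the gradients span.\<close>

section \<open>Calculus of \<open>C_on\<close>\<close>

text \<open>Derivatives at a point depend only on values nearby, so on an open set equality passes
  to the directional derivatives and the induction goes through. This is what allows a derivative to
  be replaced by a formula valid on \<open>S\<close> alone.\<close>

lemma C_on_cong:
  assumes "C_on k S f" "open S" "\<And>x. x \<in> S \<Longrightarrow> f x = g x"
  shows "C_on k S g"
  using assms(1,3)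
proof (induction k arbitrary: f g)
  case 0
  then show ?case using continuous_on_eq by auto
next
  case (Suc k)
  have diff: "f differentiable at x" if "x \<in> S" for x
    using Suc.prems(1) that by simp
  have "g differentiable at x" if "x \<in> S" for x
    using diff[OF that] has_derivative_transform_within_open[of f _ x UNIV, OF _ assms(2) that Suc.prems(2)]
    unfolding differentiable_def by blast
  moreover have "C_on k S (\<lambda>x. frechet_derivative g (at x) v)" for v
  proof (rule Suc.IH)
    show "C_on k S (\<lambda>x. frechet_derivative f (at x) v)"
      using Suc.prems(1) by simp
    show "frechet_derivative f (at x) v = frechet_derivative g (at x) v" if "x \<in> S" for x
      using frechet_derivative_transform_within_open[OF diff[OF that] assms(2) that Suc.prems(2)]
      by simp
  qed
  ultimately show ?case by simp
qed

lemma C_on_subset: "C_on k S f \<Longrightarrow> T \<subseteq> S \<Longrightarrow> C_on k T f"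
  by (induction k arbitrary: f) (auto intro: continuous_on_subset)

lemma C_on_Suc_imp: "C_on (Suc k) S f \<Longrightarrow> C_on k S f"
proof (induction k arbitrary: f)
  case 0
  then show ?case
    by (auto intro!: continuous_at_imp_continuous_on differentiable_imp_continuous_within)
qed auto

lemma C_on_mono: "C_on k S f \<Longrightarrow> j \<le> k \<Longrightarrow> C_on j S f"
  by (induction k) (metis le_zero_eq, metis C_on_Suc_imp le_SucE)

lemma C_on_const: "C_on k S (\<lambda>x. c)"
  by (induction k arbitrary: c) simp_all

section \<open>Sum, product and chain rules\<close>

lemma frechet_derivative_plus:
  assumes "f differentiable at x" "g differentiable at x"
  shows "frechet_derivative (\<lambda>x. f x + g x) (at x) v =
    frechet_derivative f (at x) v + frechet_derivative g (at x) v"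
proof -
  have "((\<lambda>x. f x + g x) has_derivative
      (\<lambda>v. frechet_derivative f (at x) v + frechet_derivative g (at x) v)) (at x)"
    using assms by (intro has_derivative_add) (simp_all add: frechet_derivative_works[symmetric])
  from frechet_derivative_at[OF this] show ?thesis by metis
qed

lemma frechet_derivative_mult:
  fixes f g :: "'a::real_normed_vector \<Rightarrow> real"
  assumes "f differentiable at x" "g differentiable at x"
  shows "frechet_derivative (\<lambda>x. f x * g x) (at x) v =
    f x * frechet_derivative g (at x) v + frechet_derivative f (at x) v * g x"
proof -
  have "((\<lambda>x. f x * g x) has_derivative
      (\<lambda>v. f x * frechet_derivative g (at x) v + frechet_derivative f (at x) v * g x)) (at x)"
    using assms by (intro has_derivative_mult) (simp_all add: frechet_derivative_works[symmetric])
  from frechet_derivative_at[OF this] show ?thesis by metis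
qed

lemma frechet_derivative_real:
  fixes f :: "real \<Rightarrow> real"
  assumes "f differentiable at x"
  shows "frechet_derivative f (at x) v = deriv f x * v"
proof -
  have "(f has_real_derivative deriv f x) (at x)"
    using assms by (simp add: DERIV_deriv_iff_real_differentiable)
  then have "(f has_derivative (\<lambda>v. deriv f x * v)) (at x)"
    by (simp add: has_field_derivative_def)
  from frechet_derivative_at[OF this] show ?thesis by metis
qed

lemma differentiable_compose_real:
  fixes \<theta> :: "real \<Rightarrow> real"
  assumes "\<theta> differentiable at (g x)" "g differentiable at x"
  shows "(\<lambda>x. \<theta> (g x)) differentiable at x"
  using differentiable_chain_at[OF assms(2,1)] by (simp add: o_def)

lemma frechet_derivative_compose_real:
  fixes \<theta> :: "real \<Rightarrow> real"
  assumes "\<theta> differentiable at (g x)" "g differentiable at x"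
  shows "frechet_derivative (\<lambda>x. \<theta> (g x)) (at x) v =
    deriv \<theta> (g x) * frechet_derivative g (at x) v"
  using frechet_derivative_compose[OF assms(2,1)] frechet_derivative_real[OF assms(1)]
  by (simp add: o_def)

lemma C_on_add:
  assumes "open S"
  shows "C_on k S f \<Longrightarrow> C_on k S g \<Longrightarrow> C_on k S (\<lambda>x. f x + g x)"
proof (induction k arbitrary: f g)
  case 0
  then show ?case by (simp add: continuous_on_add)
next
  case (Suc k)
  have "C_on k S (\<lambda>x. frechet_derivative (\<lambda>x. f x + g x) (at x) v)" for v
  proof (rule C_on_cong[OF _ assms])
    show "C_on k S (\<lambda>x. frechet_derivative f (at x) v + frechet_derivative g (at x) v)"
      by (rule Suc.IH) (use Suc.prems in simp_all)
  qed (use Suc.prems in \<open>simp add: frechet_derivative_plus\<close>)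
  with Suc.prems show ?case by simp
qed

lemma C_on_sum:
  assumes "finite I" "open S" "\<And>i. i \<in> I \<Longrightarrow> C_on k S (f i)"
  shows "C_on k S (\<lambda>x. \<Sum>i\<in>I. f i x)"
  using assms(1,3)
proof (induction I rule: finite_induct)
  case empty
  then show ?case using C_on_const by simp
next
  case (insert i I)
  then show ?case using C_on_add[OF assms(2), of k "f i"] by simp
qed

text \<open>In each term of the product rule one factor is differentiated and the other is not;
  lowering the order of the latter by one puts both in the class covered by the induction
  hypothesis.\<close>

lemma C_on_mult:
  assumes "open S"
  shows "C_on k S f \<Longrightarrow> C_on k S g \<Longrightarrow> C_on k S (\<lambda>x. f x * g x)"
proof (induction k arbitrary: f g)
  case 0
  then show ?case by (simp add: continuous_on_mult)
next
  case (Suc k)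
  have "C_on k S (\<lambda>x. frechet_derivative (\<lambda>x. f x * g x) (at x) v)" for v
  proof (rule C_on_cong[OF _ assms])
    show "C_on k S (\<lambda>x. f x * frechet_derivative g (at x) v + frechet_derivative f (at x) v * g x)"
      by (rule C_on_add[OF assms]; rule Suc.IH)
        (use Suc.prems C_on_Suc_imp[OF Suc.prems(1)] C_on_Suc_imp[OF Suc.prems(2)] in simp_all)
  qed (use Suc.prems in \<open>simp add: frechet_derivative_mult\<close>)
  with Suc.prems show ?case by simp
qed

lemma C_on_deriv:
  fixes \<theta> :: "real \<Rightarrow> real"
  assumes "C_on (Suc k) T \<theta>" "open T"
  shows "C_on k T (deriv \<theta>)"
proof (rule C_on_cong[OF _ assms(2)])
  show "C_on k T (\<lambda>s. frechet_derivative \<theta> (at s) 1)"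
    using assms(1) by simp
qed (use assms(1) in \<open>simp add: frechet_derivative_real\<close>)

text \<open>By the chain rule a directional derivative is \<open>deriv \<theta>\<close> composed
  with the same \<open>g\<close>, times a directional derivative of \<open>g\<close>. Hence the
  induction keeps \<open>g\<close> fixed, lets \<open>\<theta>\<close> vary, and closes with the
  product lemma.\<close>

lemma C_on_compose:
  fixes \<theta> :: "real \<Rightarrow> real"
  assumes "open S" "open T" "g ` S \<subseteq> T"
  shows "C_on k T \<theta> \<Longrightarrow> C_on k S g \<Longrightarrow> C_on k S (\<lambda>x. \<theta> (g x))"
proof (induction k arbitrary: \<theta>)
  case 0
  then show ?case using assms(3) by (auto intro: continuous_on_compose2)
next
  case (Suc k)
  have diff: "\<theta> differentiable at (g x)" "g differentiable at x" if "x \<in> S" for x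
    using Suc.prems assms(3) that by auto
  have "C_on k S (\<lambda>x. frechet_derivative (\<lambda>x. \<theta> (g x)) (at x) v)" for v
  proof (rule C_on_cong[OF _ assms(1)])
    show "C_on k S (\<lambda>x. deriv \<theta> (g x) * frechet_derivative g (at x) v)"
    proof (rule C_on_mult[OF assms(1)])
      show "C_on k S (\<lambda>x. deriv \<theta> (g x))"
        by (rule Suc.IH[OF C_on_deriv[OF Suc.prems(1) assms(2)] C_on_Suc_imp[OF Suc.prems(2)]])
      show "C_on k S (\<lambda>x. frechet_derivative g (at x) v)"
        using Suc.prems(2) by simp
    qed
  qed (simp add: diff frechet_derivative_compose_real)
  with diff show ?case by (simp add: differentiable_compose_real)
qed

text \<open>Restriction to a line turns directional derivatives into ordinary ones, so that the mean
  value theorem and sign criteria for one real variable become available.\<close>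

lemma has_real_derivative_along_line:
  fixes f :: "'a::real_normed_vector \<Rightarrow> real"
  assumes "f differentiable at (w + t *\<^sub>R v)"
  shows "((\<lambda>t. f (w + t *\<^sub>R v)) has_real_derivative frechet_derivative f (at (w + t *\<^sub>R v)) v) (at t)"
proof -
  let ?D = "frechet_derivative f (at (w + t *\<^sub>R v))"
  have D: "(f has_derivative ?D) (at (w + t *\<^sub>R v))"
    using assms frechet_derivative_works by blast
  have "((\<lambda>t. f (w + t *\<^sub>R v)) has_derivative (\<lambda>s. ?D (s *\<^sub>R v))) (at t)"
    by (rule has_derivative_compose[where g = f]) (auto intro!: derivative_eq_intros D)
  then show ?thesis
    using linear_cmul[OF has_derivative_linear[OF D]]
    by (simp add: has_field_derivative_def mult_commute_abs)
qed
section \<open>Gradient and Hessian\<close>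

text \<open>With the base point as last argument the directional derivative is again a scalar
  function, so it can be iterated: second derivatives are
  \<open>dir_deriv (dir_deriv f u) v\<close>, differentiated along \<open>u\<close> first.\<close>

abbreviation dir_deriv :: "('a::real_normed_vector \<Rightarrow> real) \<Rightarrow> 'a \<Rightarrow> 'a \<Rightarrow> real" where
  "dir_deriv f v \<equiv> (\<lambda>x. frechet_derivative f (at x) v)"

lemma C_on_2D:
  assumes "C_on 2 S f"
  shows "\<And>x. x \<in> S \<Longrightarrow> f differentiable at x"
    and "\<And>x v. x \<in> S \<Longrightarrow> dir_deriv f v differentiable at x"
    and "\<And>u v. continuous_on S (dir_deriv (dir_deriv f u) v)"
  using assms by (auto simp: numeral_2_eq_2)

text \<open>The second difference is symmetric in \<open>u\<close> and \<open>v\<close>, whence Schwarz' theorem below.\<close>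

lemma second_difference_mvt:
  assumes "C_on 2 S f" "h > 0"
    and S: "\<And>s t. 0 \<le> s \<Longrightarrow> s \<le> h \<Longrightarrow> 0 \<le> t \<Longrightarrow> t \<le> h \<Longrightarrow> x + s *\<^sub>R u + t *\<^sub>R v \<in> S"
  obtains s t where "0 < s" "s < h" "0 < t" "t < h"
    "f (x + h *\<^sub>R u + h *\<^sub>R v) - f (x + h *\<^sub>R u) - f (x + h *\<^sub>R v) + f x =
      h\<^sup>2 * dir_deriv (dir_deriv f u) v (x + s *\<^sub>R u + t *\<^sub>R v)"
proof -
  note D = C_on_2D[OF assms(1)]
  \<comment> \<open>The second difference is \<open>F h - F 0\<close>, where \<open>F\<close> is the
    increment of \<open>f\<close> in direction \<open>v\<close>. The mean value theorem is applied
    to \<open>F\<close> in \<open>s\<close>, and then in \<open>t\<close> to the resulting increment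
    of the first derivative.\<close>
  define F where "F s = f ((x + h *\<^sub>R v) + s *\<^sub>R u) - f (x + s *\<^sub>R u)" for s
  have S1: "(x + h *\<^sub>R v) + s *\<^sub>R u \<in> S" "x + s *\<^sub>R u \<in> S" if "0 \<le> s" "s \<le> h" for s
    using S[of s h] S[of s 0] that assms(2) by (simp_all add: algebra_simps)
  have "DERIV F s :> dir_deriv f u ((x + h *\<^sub>R v) + s *\<^sub>R u) - dir_deriv f u (x + s *\<^sub>R u)"
    if "0 \<le> s" "s \<le> h" for s
    unfolding F_def by (intro DERIV_diff has_real_derivative_along_line D S1 that)
  from MVT2[OF assms(2) this] obtain s where s: "0 < s" "s < h"
    "F h - F 0 = h * (dir_deriv f u ((x + h *\<^sub>R v) + s *\<^sub>R u) - dir_deriv f u (x + s *\<^sub>R u))"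
    by auto
  have "DERIV (\<lambda>t. dir_deriv f u ((x + s *\<^sub>R u) + t *\<^sub>R v)) t :>
      dir_deriv (dir_deriv f u) v ((x + s *\<^sub>R u) + t *\<^sub>R v)" if "0 \<le> t" "t \<le> h" for t
    by (intro has_real_derivative_along_line D S that less_imp_le s)
  from MVT2[OF assms(2) this] obtain t where t: "0 < t" "t < h"
    "dir_deriv f u ((x + s *\<^sub>R u) + h *\<^sub>R v) - dir_deriv f u ((x + s *\<^sub>R u) + 0 *\<^sub>R v) =
      h * dir_deriv (dir_deriv f u) v (x + s *\<^sub>R u + t *\<^sub>R v)"
    by auto
  have "F h - F 0 = h\<^sup>2 * dir_deriv (dir_deriv f u) v (x + s *\<^sub>R u + t *\<^sub>R v)"
    using s(3) t(3) by (simp add: power2_eq_square algebra_simps)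
  then show thesis
    using s t that by (simp add: F_def algebra_simps)
qed

lemma dir_deriv_commute:
  assumes "C_on 2 S f" "open S" "x \<in> S"
  shows "dir_deriv (dir_deriv f u) v x = dir_deriv (dir_deriv f v) u x"
proof -
  let ?A = "dir_deriv (dir_deriv f u) v" and ?B = "dir_deriv (dir_deriv f v) u"
  have "\<bar>?A x - ?B x\<bar> \<le> e" if "e > 0" for e
  proof -
    have "\<forall>\<^sub>F y in nhds x. y \<in> S \<and> dist (?A y) (?A x) < e / 2 \<and> dist (?B y) (?B x) < e / 2"
    proof (intro eventually_conj)
      show "\<forall>\<^sub>F y in nhds x. y \<in> S"
        using assms by (simp add: eventually_nhds_in_open)
      have "isCont ?A x" "isCont ?B x"
        using C_on_2D(3)[OF assms(1)] assms(2,3) by (auto simp: continuous_on_eq_continuous_at)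
      then have "\<forall>\<^sub>F y in at x. dist (?A y) (?A x) < e / 2" "\<forall>\<^sub>F y in at x. dist (?B y) (?B x) < e / 2"
        using half_gt_zero[OF that] unfolding isCont_def tendsto_iff by blast+
      then show "\<forall>\<^sub>F y in nhds x. dist (?A y) (?A x) < e / 2" "\<forall>\<^sub>F y in nhds x. dist (?B y) (?B x) < e / 2"
        using that by (simp_all add: eventually_nhds_conv_at)
    qed
    then obtain d where d: "d > 0" and
      near: "\<And>y. dist y x < d \<Longrightarrow> y \<in> S \<and> dist (?A y) (?A x) < e / 2 \<and> dist (?B y) (?B x) < e / 2"
      unfolding eventually_nhds_metric by blast
    \<comment> \<open>The side \<open>h\<close> is chosen so that the whole parallelogram spanned by
      \<open>h *\<^sub>R u\<close> and \<open>h *\<^sub>R v\<close> stays within distance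
      \<open>d\<close> of \<open>x\<close>; the summand 1 keeps the denominator positive when both
      vectors vanish.\<close>
    define h where "h = d / (norm u + norm v + 1)"
    have "norm u + norm v + 1 > 0"
      using norm_ge_zero[of u] norm_ge_zero[of v] by linarith
    then have h: "h > 0" and hd: "h * (norm u + norm v) < d"
      using d by (simp_all add: h_def field_simps)
    have close: "dist (x + s *\<^sub>R u + t *\<^sub>R v) x < d" if "0 \<le> s" "s \<le> h" "0 \<le> t" "t \<le> h" for s t
    proof -
      have "dist (x + s *\<^sub>R u + t *\<^sub>R v) x \<le> s * norm u + t * norm v"
        using norm_triangle_ineq[of "s *\<^sub>R u" "t *\<^sub>R v"] that by (simp add: dist_norm)
      also have "\<dots> \<le> h * norm u + h * norm v"
        using that by (intro add_mono mult_right_mono) simp_all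
      finally show ?thesis using hd by (simp add: algebra_simps)
    qed
    have close': "dist (x + s *\<^sub>R v + t *\<^sub>R u) x < d" if "0 \<le> s" "s \<le> h" "0 \<le> t" "t \<le> h" for s t
      using close[OF that(3,4,1,2)] by (simp add: algebra_simps)
    obtain s t where 1: "0 < s" "s < h" "0 < t" "t < h"
      "f (x + h *\<^sub>R u + h *\<^sub>R v) - f (x + h *\<^sub>R u) - f (x + h *\<^sub>R v) + f x = h\<^sup>2 * ?A (x + s *\<^sub>R u + t *\<^sub>R v)"
      using second_difference_mvt[OF assms(1) h] close near by blast
    obtain s' t' where 2: "0 < s'" "s' < h" "0 < t'" "t' < h"
      "f (x + h *\<^sub>R v + h *\<^sub>R u) - f (x + h *\<^sub>R v) - f (x + h *\<^sub>R u) + f x = h\<^sup>2 * ?B (x + s' *\<^sub>R v + t' *\<^sub>R u)"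
      using second_difference_mvt[OF assms(1) h] close' near by blast
    have "f (x + h *\<^sub>R v + h *\<^sub>R u) = f (x + h *\<^sub>R u + h *\<^sub>R v)"
      by (simp add: algebra_simps)
    then have "h\<^sup>2 * ?A (x + s *\<^sub>R u + t *\<^sub>R v) = h\<^sup>2 * ?B (x + s' *\<^sub>R v + t' *\<^sub>R u)"
      using 1(5) 2(5) by linarith
    then have "?A (x + s *\<^sub>R u + t *\<^sub>R v) = ?B (x + s' *\<^sub>R v + t' *\<^sub>R u)"
      using h by simp
    moreover have "dist (?A (x + s *\<^sub>R u + t *\<^sub>R v)) (?A x) < e / 2"
      "dist (?B (x + s' *\<^sub>R v + t' *\<^sub>R u)) (?B x) < e / 2"
      using near[OF close[of s t]] near[OF close'[of s' t']] 1(1-4) 2(1-4) by auto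
    ultimately show ?thesis
      unfolding dist_real_def by linarith
  qed
  \<comment> \<open>With half the gap itself as \<open>e\<close>, a positive gap would be at most
    half of itself.\<close>
  from this[of "\<bar>?A x - ?B x\<bar> / 2"] show ?thesis by force
qed

text \<open>\<open>grad\<close> is a definite description, so existence and uniqueness are both due:
  the adjoint of the derivative, evaluated at 1, represents it as an inner product, and Frechet
  derivatives are unique.\<close>

lemma GDERIV_grad:
  assumes "f differentiable at x"
  shows "GDERIV f x :> grad f x"
proof -
  let ?D = "frechet_derivative f (at x)"
  have D: "(f has_derivative ?D) (at x)"
    using assms frechet_derivative_works by blast
  have "?D = (\<lambda>v. v \<bullet> adjoint ?D 1)"
    using adjoint_works[OF has_derivative_linear[OF D], of _ 1] by (simp add: fun_eq_iff)
  then have ex: "GDERIV f x :> adjoint ?D 1"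
    using D by (simp add: gderiv_def)
  have "E = adjoint ?D 1" if "GDERIV f x :> E" for E
  proof -
    have "(\<lambda>v. v \<bullet> E) = (\<lambda>v. v \<bullet> adjoint ?D 1)"
      using that ex unfolding gderiv_def by (rule has_derivative_unique)
    then have "v \<bullet> E = v \<bullet> adjoint ?D 1" for v
      by (rule fun_cong)
    then show ?thesis using vector_eq_ldot by blast
  qed
  with ex show ?thesis unfolding grad_def by (rule theI)
qed

lemma inner_grad:
  assumes "f differentiable at x"
  shows "v \<bullet> grad f x = dir_deriv f v x"
  using fun_cong[OF frechet_derivative_at[OF GDERIV_grad[OF assms, unfolded gderiv_def]], of v] .

lemma grad_eq_sum:
  assumes "f differentiable at x"
  shows "grad f x = (\<Sum>b\<in>Basis. dir_deriv f b x *\<^sub>R b)"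
  using euclidean_representation[of "grad f x"] inner_grad[OF assms] by (simp add: inner_commute)

text \<open>The gradient is the basis expansion of the directional derivatives, each of which is
  differentiable; so the Jacobian in \<open>hessian\<close> really is the derivative of
  \<open>grad f\<close>, and pairing with \<open>u\<close> recovers
  \<open>dir_deriv f u\<close>.\<close>

lemma inner_hessian:
  assumes "C_on 2 S f" "open S" "x \<in> S"
  shows "u \<bullet> (hessian f x *v v) = dir_deriv (dir_deriv f u) v x"
proof -
  note D = C_on_2D[OF assms(1)]
  have "((\<lambda>y. \<Sum>b\<in>Basis. dir_deriv f b y *\<^sub>R b) has_derivative
      (\<lambda>v. \<Sum>b\<in>Basis. dir_deriv (dir_deriv f b) v x *\<^sub>R b)) (at x)"
    using D(2)[OF assms(3)]
    by (auto intro!: has_derivative_sum has_derivative_scaleR_left simp: frechet_derivative_works[symmetric])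
  then have "(grad f has_derivative (\<lambda>v. \<Sum>b\<in>Basis. dir_deriv (dir_deriv f b) v x *\<^sub>R b)) (at x)"
    by (rule has_derivative_transform_within_open[OF _ assms(2,3)]) (simp add: grad_eq_sum D)
  then have "(grad f has_derivative (\<lambda>v. hessian f x *v v)) (at x)"
    unfolding hessian_def using jacobian_works differentiable_def by blast
  then have "((\<lambda>y. u \<bullet> grad f y) has_derivative (\<lambda>v. u \<bullet> (hessian f x *v v))) (at x)"
    by (rule has_derivative_inner_right)
  then have "(dir_deriv f u has_derivative (\<lambda>v. u \<bullet> (hessian f x *v v))) (at x)"
    by (rule has_derivative_transform_within_open[OF _ assms(2,3)]) (simp add: inner_grad D)
  from frechet_derivative_at[OF this] show ?thesis by metis
qed

lemma hessian_component:
  assumes "C_on 2 S f" "open S" "x \<in> S"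
  shows "hessian f x $ i $ j = dir_deriv (dir_deriv f (axis i 1)) (axis j 1) x"
  using inner_hessian[OF assms, of "axis i 1" "axis j 1"]
  by (simp add: inner_axis' matrix_vector_mult_basis column_def)

lemma transpose_hessian:
  assumes "C_on 2 S f" "open S" "x \<in> S"
  shows "transpose (hessian f x) = hessian f x"
proof -
  have "hessian f x $ i $ j = hessian f x $ j $ i" for i j
    unfolding hessian_component[OF assms] by (rule dir_deriv_commute[OF assms])
  then show ?thesis by (simp add: vec_eq_iff transpose_def)
qed

section \<open>Local Lipschitz continuity of the Hessian\<close>

text \<open>Partial derivatives are bounded on a compact ball inside \<open>S\<close>; the gradient
  norm is at most the sum of these bounds, and the ball is convex, so the mean value inequality
  applies.\<close>

lemma C_on_1_locally_lipschitz:
  assumes "C_on 1 S f" "open S" "x \<in> S"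
  obtains r L where "r > 0" "cball x r \<subseteq> S" "L-lipschitz_on (cball x r) f"
proof -
  obtain r where r: "r > 0" "cball x r \<subseteq> S"
    using assms(2,3) open_contains_cball by blast
  have diff: "f differentiable at y" if "y \<in> S" for y
    using assms(1) that by simp
  have "\<exists>M. \<forall>y\<in>cball x r. \<bar>dir_deriv f b y\<bar> \<le> M" for b
  proof -
    have "compact (dir_deriv f b ` cball x r)"
      using assms(1) r(2) by (intro compact_continuous_image) (auto intro: continuous_on_subset)
    then have "bounded (dir_deriv f b ` cball x r)"
      by (rule compact_imp_bounded)
    then show ?thesis
      unfolding bounded_iff by simp
  qed
  then obtain M where M: "\<And>b y. y \<in> cball x r \<Longrightarrow> \<bar>dir_deriv f b y\<bar> \<le> M b"
    by metis
  define L where "L = (\<Sum>b\<in>Basis. M b)"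
  have "M b \<ge> 0" for b
    using M[of x b] r(1) abs_ge_zero[of "dir_deriv f b x"] by (simp del: abs_ge_zero)
  then have L0: "L \<ge> 0" by (simp add: L_def sum_nonneg)
  have "norm (frechet_derivative f (at y) v) \<le> L * norm v" if "y \<in> cball x r" for y v
  proof -
    have "norm (grad f y) \<le> (\<Sum>b\<in>Basis. \<bar>grad f y \<bullet> b\<bar>)"
      by (rule norm_le_l1)
    also have "\<dots> \<le> L"
      unfolding L_def
      using M[OF that] inner_grad[OF diff, of y] that r(2)
      by (intro sum_mono) (auto simp: inner_commute)
    finally have "norm v * norm (grad f y) \<le> norm v * L"
      by (rule mult_left_mono) simp
    moreover have "norm (frechet_derivative f (at y) v) = \<bar>v \<bullet> grad f y\<bar>"
      using inner_grad[OF diff] that r(2) by auto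
    ultimately show ?thesis
      using Cauchy_Schwarz_ineq2[of v "grad f y"] by (simp add: mult.commute)
  qed
  then have on: "onorm (frechet_derivative f (at y)) \<le> L" if "y \<in> cball x r" for y
    using that by (intro onorm_le) blast
  have der: "(f has_derivative frechet_derivative f (at y)) (at y within cball x r)" if "y \<in> cball x r" for y
    using diff[of y] that r(2) frechet_derivative_works has_derivative_at_withinI by blast
  have "norm (f y - f z) \<le> L * norm (y - z)" if "y \<in> cball x r" "z \<in> cball x r" for y z
    using differentiable_bound[OF convex_cball der on that] by simp
  then have "L-lipschitz_on (cball x r) f"
    using L0 by (intro lipschitz_onI) (auto simp: dist_norm)
  with r that show thesis by blast
qed

text \<open>Each entry is a second directional derivative of a $C^3$ function, hence $C^1$ and
  locally Lipschitz. The distance of two matrices is at most the sum of the entrywise distances, so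
  the constants add up.\<close>

lemma hessian_locally_lipschitz:
  assumes "C_on 3 S f" "open S"
  shows "locally_lipschitz_on S (hessian f)"
proof (rule local_lipschitzI)
  fix x assume x: "x \<in> S"
  have C2: "C_on 2 S f" using assms(1) by (rule C_on_mono) simp
  let ?h = "\<lambda>i j y. hessian f y $ i $ j"
  have "\<exists>r L. r > 0 \<and> cball x r \<subseteq> S \<and> L-lipschitz_on (cball x r) (?h i j)" for i j
  proof -
    have "C_on 1 S (dir_deriv (dir_deriv f (axis i 1)) (axis j 1))"
      using assms(1) by (simp add: numeral_3_eq_3)
    then have "C_on 1 S (?h i j)"
      by (rule C_on_cong[OF _ assms(2)]) (simp add: hessian_component[OF C2 assms(2)])
    then show ?thesis
      by (rule C_on_1_locally_lipschitz[OF _ assms(2) x]) blast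
  qed
  then obtain r L where r: "\<And>i j. r i j > 0" "\<And>i j. cball x (r i j) \<subseteq> S"
    and L: "\<And>i j. (L i j)-lipschitz_on (cball x (r i j)) (?h i j)"
    by metis
  \<comment> \<open>Only finitely many entries occur, so the smallest of their radii is positive and
    serves all of them.\<close>
  define u where "u = Min (range (\<lambda>(i, j). r i j))"
  have u: "u > 0" "\<And>i j. u \<le> r i j"
    unfolding u_def using r(1) by (auto intro!: Min_le)
  have "(\<Sum>i\<in>UNIV. \<Sum>j\<in>UNIV. L i j)-lipschitz_on (cball x u \<inter> S) (hessian f)"
  proof (rule lipschitz_onI)
    fix y z assume yz: "y \<in> cball x u \<inter> S" "z \<in> cball x u \<inter> S"
    have "dist (hessian f y) (hessian f z) \<le> (\<Sum>i\<in>UNIV. dist (hessian f y $ i) (hessian f z $ i))"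
      unfolding dist_vec_def by (rule L2_set_le_sum) simp
    also have "\<dots> \<le> (\<Sum>i\<in>UNIV. \<Sum>j\<in>UNIV. dist (?h i j y) (?h i j z))"
      unfolding dist_vec_def[where 'a = real] by (intro sum_mono L2_set_le_sum) simp
    also have "\<dots> \<le> (\<Sum>i\<in>UNIV. \<Sum>j\<in>UNIV. L i j * dist y z)"
      using yz u(2) by (intro sum_mono lipschitz_onD[OF L]) (auto intro: order_trans)
    finally show "dist (hessian f y) (hessian f z) \<le> (\<Sum>i\<in>UNIV. \<Sum>j\<in>UNIV. L i j) * dist y z"
      by (simp add: sum_distrib_right)
  qed (auto intro!: sum_nonneg lipschitz_on_nonneg[OF L])
  with u(1) show "\<exists>u>0. \<exists>L. \<forall>t\<in>cball t u \<inter> {0}. L-lipschitz_on (cball x u \<inter> S) (hessian f)" for t :: real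
    by blast
qed
section \<open>Convexity\<close>

text \<open>Used for lower semicontinuity of sums. A real \<open>r\<close> strictly between
  \<open>y\<close> and \<open>a + b\<close> is split as \<open>c + d\<close>: if both summands are
  finite the slack is shared equally, otherwise an infinite summand absorbs the rest.\<close>

lemma ereal_less_add_split:
  fixes a b y :: ereal
  assumes "y < a + b" "a \<noteq> -\<infinity>" "b \<noteq> -\<infinity>"
  obtains c d :: real where "ereal c < a" "ereal d < b" "y < ereal (c + d)"
proof -
  obtain r where r: "y < ereal r" "ereal r < a + b"
    using ereal_dense2[OF assms(1)] by blast
  have "\<exists>c d. ereal c < a \<and> ereal d < b \<and> c + d = r"
  proof (cases a; cases b)
    fix a' b' assume *: "a = ereal a'" "b = ereal b'"
    then show ?thesis
      using r(2) by (intro exI[of _ "a' - (a' + b' - r) / 2"] exI[of _ "b' - (a' + b' - r) / 2"])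
        (simp add: field_simps)
  next
    fix a' assume "a = ereal a'" "b = \<infinity>"
    then show ?thesis
      by (intro exI[of _ "a' - 1"] exI[of _ "r - (a' - 1)"]) simp
  next
    fix b' assume "a = \<infinity>" "b = ereal b'"
    then show ?thesis
      by (intro exI[of _ "r - (b' - 1)"] exI[of _ "b' - 1"]) simp
  next
    assume "a = \<infinity>" "b = \<infinity>"
    then show ?thesis
      by (intro exI[of _ r] exI[of _ 0]) simp
  qed (use assms in simp_all)
  with r(1) that show thesis by metis
qed

lemma Gamma0D:
  assumes "f \<in> Gamma0"
  shows "f x \<noteq> -\<infinity>" "f x \<le> Liminf (at x) f"
    and "0 < t \<Longrightarrow> t < 1 \<Longrightarrow> f ((1 - t) *\<^sub>R x + t *\<^sub>R y) \<le> ereal (1 - t) * f x + ereal t * f y"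
  using assms by (auto simp: Gamma0_def)

lemma Gamma0_const: "(\<lambda>x. ereal c) \<in> Gamma0"
  by (auto simp: Gamma0_def eff_dom_def le_Liminf_iff algebra_simps)

text \<open>The common point \<open>z\<close> is there for properness: without it the two effective
  domains could be disjoint and the sum identically \<open>\<infinity>\<close>.\<close>

lemma Gamma0_add:
  assumes f: "f \<in> Gamma0" and g: "g \<in> Gamma0" and z: "z \<in> eff_dom f" "z \<in> eff_dom g"
  shows "(\<lambda>x. f x + g x) \<in> Gamma0"
  unfolding Gamma0_def
proof (intro CollectI conjI allI ballI)
  show "f x + g x \<noteq> -\<infinity>" for x
    using Gamma0D(1)[OF f, of x] Gamma0D(1)[OF g, of x] by (cases "f x"; cases "g x") auto
  have "z \<in> eff_dom (\<lambda>x. f x + g x)"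
    using z by (cases "f z"; cases "g z") (simp_all add: eff_dom_def)
  then show "eff_dom (\<lambda>x. f x + g x) \<noteq> {}" by blast
  show "f x + g x \<le> Liminf (at x) (\<lambda>x. f x + g x)" for x
    unfolding le_Liminf_iff
  proof (intro allI impI)
    fix y assume "y < f x + g x"
    then obtain c d where cd: "ereal c < f x" "ereal d < g x" "y < ereal (c + d)"
      using ereal_less_add_split Gamma0D(1)[OF f] Gamma0D(1)[OF g] by metis
    have "\<forall>\<^sub>F u in at x. ereal c < f u" "\<forall>\<^sub>F u in at x. ereal d < g u"
      using Gamma0D(2)[OF f, of x] Gamma0D(2)[OF g, of x] cd unfolding le_Liminf_iff by blast+
    then show "\<forall>\<^sub>F u in at x. y < f u + g u"
    proof eventually_elim
      case (elim u)
      have "y < ereal c + ereal d" using cd(3) by simp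
      also have "\<dots> \<le> f u + g u" using elim by (intro add_mono) simp_all
      finally show ?case .
    qed
  qed
  fix x y :: 'a and t :: real assume "t \<in> {0<..<1}"
  then have t: "0 < t" "t < 1" by auto
  have "f ((1 - t) *\<^sub>R x + t *\<^sub>R y) + g ((1 - t) *\<^sub>R x + t *\<^sub>R y) \<le>
      (ereal (1 - t) * f x + ereal t * f y) + (ereal (1 - t) * g x + ereal t * g y)"
    by (intro add_mono Gamma0D(3) f g t)
  also have "\<dots> = ereal (1 - t) * (f x + g x) + ereal t * (f y + g y)"
    using t by (simp add: ereal_pos_distrib ac_simps)
  finally show "f ((1 - t) *\<^sub>R x + t *\<^sub>R y) + g ((1 - t) *\<^sub>R x + t *\<^sub>R y) \<le>
      ereal (1 - t) * (f x + g x) + ereal t * (f y + g y)" .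
qed

lemma Gamma0_sum:
  assumes "finite I" "\<And>i. i \<in> I \<Longrightarrow> f i \<in> Gamma0" "\<And>i. i \<in> I \<Longrightarrow> z \<in> eff_dom (f i)"
  shows "(\<lambda>x. \<Sum>i\<in>I. f i x) \<in> Gamma0"
  using assms
proof (induction I rule: finite_induct)
  case empty
  then show ?case using Gamma0_const[of 0] by (simp add: zero_ereal_def)
next
  case (insert i I)
  have "z \<in> eff_dom (\<lambda>x. \<Sum>i\<in>I. f i x)"
    using insert.prems(2) by (auto simp: eff_dom_def sum_Pinfty)
  then have "(\<lambda>x. f i x + (\<Sum>i\<in>I. f i x)) \<in> Gamma0"
    using insert by (intro Gamma0_add[of _ _ z]) simp_all
  then show ?case using insert.hyps by simp
qed

text \<open>The last hypothesis is the common consequence of both alternatives in (iv): a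
  non-increasing \<open>\<theta>\<close> with concave \<open>g\<close>, or an affine
  \<open>g\<close>. Convexity of \<open>\<theta>\<close> then finishes the estimate.\<close>

lemma Gamma0_compose:
  fixes \<theta> :: "real \<Rightarrow> ereal"
  assumes "\<theta> \<in> Gamma0" "continuous_on UNIV g" "g z \<in> eff_dom \<theta>"
    and le: "\<And>x y t. 0 < t \<Longrightarrow> t < 1 \<Longrightarrow>
      \<theta> (g ((1 - t) *\<^sub>R x + t *\<^sub>R y)) \<le> \<theta> ((1 - t) * g x + t * g y)"
  shows "(\<lambda>x. \<theta> (g x)) \<in> Gamma0"
  unfolding Gamma0_def
proof (intro CollectI conjI allI ballI)
  show "\<theta> (g x) \<noteq> -\<infinity>" for x by (rule Gamma0D(1)[OF assms(1)])
  show "eff_dom (\<lambda>x. \<theta> (g x)) \<noteq> {}"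
    using assms(3) by (auto simp: eff_dom_def)
  show "\<theta> (g x) \<le> Liminf (at x) (\<lambda>x. \<theta> (g x))" for x
    unfolding le_Liminf_iff
  proof (intro allI impI)
    fix y assume y: "y < \<theta> (g x)"
    then have "\<forall>\<^sub>F s in at (g x). y < \<theta> s"
      using Gamma0D(2)[OF assms(1)] unfolding le_Liminf_iff by blast
    \<comment> \<open>The limit inferior ignores the point \<open>g x\<close> itself, but
      \<open>g u = g x\<close> can happen for \<open>u\<close> different from \<open>x\<close>;
      hence the passage to full neighbourhoods.\<close>
    with y have ev: "\<forall>\<^sub>F s in nhds (g x). y < \<theta> s"
      by (simp add: eventually_nhds_conv_at)
    have "(g \<longlongrightarrow> g x) (at x)"
      using assms(2) by (simp add: continuous_on_def)
    with ev show "\<forall>\<^sub>F u in at x. y < \<theta> (g u)"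
      by (rule eventually_compose_filterlim)
  qed
  fix x y :: 'a and t :: real assume "t \<in> {0<..<1}"
  then have t: "0 < t" "t < 1" by auto
  show "\<theta> (g ((1 - t) *\<^sub>R x + t *\<^sub>R y)) \<le> ereal (1 - t) * \<theta> (g x) + ereal t * \<theta> (g y)"
    using order_trans[OF le[OF t] Gamma0D(3)[OF assms(1) t, of "g x" "g y", unfolded real_scaleR_def]] .
qed

section \<open>First and second order conditions for convexity\<close>

text \<open>On the line through \<open>x\<close> and \<open>y\<close> the function
  \<open>- g\<close> is convex in one real variable, where the tangent inequality is known; it is
  read off between the parameters 0 and 1.\<close>

lemma concave_below_tangent:
  assumes "concave_on UNIV g" "g differentiable at x"
  shows "g y - g x \<le> dir_deriv g (y - x) x"
proof -
  let ?k = "\<lambda>t::real. x + t *\<^sub>R (y - x)"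
  have "convex_on UNIV (\<lambda>t. - g (?k t))"
  proof (rule convex_onI)
    fix t a b :: real assume t: "0 < t" "t < 1"
    have "?k ((1 - t) *\<^sub>R a + t *\<^sub>R b) = (1 - t) *\<^sub>R ?k a + t *\<^sub>R ?k b"
      by (simp add: algebra_simps)
    then show "- g (?k ((1 - t) *\<^sub>R a + t *\<^sub>R b)) \<le> (1 - t) * - g (?k a) + t * - g (?k b)"
      using concave_onD[OF assms(1), of t "?k a" "?k b"] t by simp
  qed simp
  moreover have "((\<lambda>t. - g (?k t)) has_real_derivative - dir_deriv g (y - x) x) (at 0)"
    using has_real_derivative_along_line[of g x 0 "y - x"] assms(2) by (intro DERIV_minus) simp
  ultimately show ?thesis
    using convex_on_imp_above_tangent[of UNIV "\<lambda>t. - g (?k t)" 0 1] by fastforce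
qed

text \<open>A positive second derivative would make the slope along \<open>v\<close> strictly larger
  at a nearby point \<open>x + (d / 2) *\<^sub>R v\<close> than at \<open>x\<close>. The tangent
  inequalities at these two points force the opposite order.\<close>

lemma concave_second_dir_deriv_nonpos:
  assumes "concave_on UNIV g" "C_on 2 UNIV g"
  shows "dir_deriv (dir_deriv g v) v x \<le> 0"
proof (rule ccontr)
  note D = C_on_2D[OF assms(2), simplified]
  assume "\<not> ?thesis"
  then have pos: "0 < dir_deriv (dir_deriv g v) v x" by simp
  have "DERIV (\<lambda>t. dir_deriv g v (x + t *\<^sub>R v)) 0 :> dir_deriv (dir_deriv g v) v x"
    using has_real_derivative_along_line[of "dir_deriv g v" x 0 v] D by simp
  from DERIV_pos_inc_right[OF this pos] obtain d where d: "d > 0"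
    "\<And>h. 0 < h \<Longrightarrow> h < d \<Longrightarrow> dir_deriv g v (x + 0 *\<^sub>R v) < dir_deriv g v (x + (0 + h) *\<^sub>R v)"
    by blast
  let ?y = "x + (d / 2) *\<^sub>R v"
  have lin: "dir_deriv g (c *\<^sub>R v) z = c * dir_deriv g v z" for c z
    using linear_cmul[OF linear_frechet_derivative[OF D(1)]] by simp
  have "g ?y - g x \<le> d / 2 * dir_deriv g v x"
    using concave_below_tangent[OF assms(1) D(1), of ?y x] lin[where c = "d / 2"] by simp
  moreover have "g x - g ?y \<le> - (d / 2) * dir_deriv g v ?y"
    using concave_below_tangent[OF assms(1) D(1), of x ?y] lin[where c = "- (d / 2)"] by simp
  moreover have "d / 2 * dir_deriv g v x < d / 2 * dir_deriv g v ?y"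
    using d(2)[of "d / 2"] d(1) by (intro mult_strict_left_mono) simp_all
  ultimately show False by linarith
qed

text \<open>Along a segment the slope \<open>\<psi>\<close> is strictly increasing, and by the mean
  value theorem the average slopes on \<open>[0, t]\<close> and \<open>[t, 1]\<close> are values of
  \<open>\<psi>\<close> at points \<open>a < b\<close>.\<close>

lemma strictly_convex_on_if_second_dir_deriv_pos:
  assumes "C_on 2 C f" "convex C"
    and pos: "\<And>x v. x \<in> C \<Longrightarrow> v \<noteq> 0 \<Longrightarrow> 0 < dir_deriv (dir_deriv f v) v x"
  shows "strictly_convex_on C f"
  unfolding strictly_convex_on_def
proof (intro conjI ballI impI assms(2))
  fix x y and t :: real assume xy: "x \<in> C" "y \<in> C" "x \<noteq> y" and "t \<in> {0<..<1}"
  then have t: "0 < t" "t < 1" by auto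
  define v where "v = y - x"
  define \<phi> where "\<phi> s = f (x + s *\<^sub>R v)" for s
  define \<psi> where "\<psi> s = dir_deriv f v (x + s *\<^sub>R v)" for s
  have line: "x + s *\<^sub>R v = (1 - s) *\<^sub>R x + s *\<^sub>R y" for s
    by (simp add: v_def algebra_simps)
  have C: "x + s *\<^sub>R v \<in> C" if "0 \<le> s" "s \<le> 1" for s
    unfolding line using assms(2) xy that by (simp add: convex_alt)
  have \<phi>: "DERIV \<phi> s :> \<psi> s" if "0 \<le> s" "s \<le> 1" for s
    unfolding \<phi>_def \<psi>_def by (intro has_real_derivative_along_line C_on_2D[OF assms(1)] C that)
  have \<psi>: "DERIV \<psi> s :> dir_deriv (dir_deriv f v) v (x + s *\<^sub>R v)" if "0 \<le> s" "s \<le> 1" for s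
    unfolding \<psi>_def by (intro has_real_derivative_along_line C_on_2D[OF assms(1)] C that)
  obtain a where a: "0 < a" "a < t" "\<phi> t - \<phi> 0 = (t - 0) * \<psi> a"
    using MVT2[OF t(1), of \<phi> \<psi>] \<phi> t by force
  obtain b where b: "t < b" "b < 1" "\<phi> 1 - \<phi> t = (1 - t) * \<psi> b"
    using MVT2[OF t(2), of \<phi> \<psi>] \<phi> t by force
  have "\<psi> a < \<psi> b"
  proof (rule DERIV_pos_imp_increasing[where f = \<psi>])
    fix s assume s: "a \<le> s" "s \<le> b"
    have "v \<noteq> 0" using xy by (simp add: v_def)
    with s a b show "\<exists>y. DERIV \<psi> s :> y \<and> y > 0"
      by (intro exI[of _ "dir_deriv (dir_deriv f v) v (x + s *\<^sub>R v)"] conjI \<psi> pos C) simp_all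
  qed (use a b in simp)
  then have "t * (1 - t) * \<psi> a < t * (1 - t) * \<psi> b"
    using t by simp
  moreover have "(1 - t) * (\<phi> t - \<phi> 0) = t * (1 - t) * \<psi> a" "t * (\<phi> 1 - \<phi> t) = t * (1 - t) * \<psi> b"
    using a(3) b(3) by simp_all
  \<comment> \<open>The height of the chord above the graph is a difference of weighted increments,
    and the weights turn both into \<open>t * (1 - t)\<close> times a slope.\<close>
  moreover have "(1 - t) * \<phi> 0 + t * \<phi> 1 - \<phi> t = t * (\<phi> 1 - \<phi> t) - (1 - t) * (\<phi> t - \<phi> 0)"
    by (simp add: algebra_simps)
  ultimately have "\<phi> t < (1 - t) * \<phi> 0 + t * \<phi> 1"
    by linarith
  then show "f ((1 - t) *\<^sub>R x + t *\<^sub>R y) < (1 - t) * f x + t * f y"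
    unfolding \<phi>_def line by simp
qed
section \<open>Composition with a barrier\<close>

lemma frechet_derivative_sum:
  assumes "\<And>i. i \<in> I \<Longrightarrow> f i differentiable at x"
  shows "frechet_derivative (\<lambda>x. \<Sum>i\<in>I. f i x) (at x) v = (\<Sum>i\<in>I. frechet_derivative (f i) (at x) v)"
proof -
  have "((\<lambda>x. \<Sum>i\<in>I. f i x) has_derivative (\<lambda>v. \<Sum>i\<in>I. frechet_derivative (f i) (at x) v)) (at x)"
    using assms by (intro has_derivative_sum) (simp add: frechet_derivative_works[symmetric])
  from frechet_derivative_at[OF this] show ?thesis by metis
qed

lemma second_dir_deriv_compose_sum:
  fixes \<theta> :: "real \<Rightarrow> real"
  assumes "C_on 2 T \<theta>" "open T" "open S" "x \<in> S"
    and g: "\<And>i. i \<in> I \<Longrightarrow> C_on 2 S (g i)" "\<And>i. i \<in> I \<Longrightarrow> g i ` S \<subseteq> T"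
  shows "dir_deriv (dir_deriv (\<lambda>x. \<Sum>i\<in>I. \<theta> (g i x)) v) v x =
    (\<Sum>i\<in>I. deriv (deriv \<theta>) (g i x) * (dir_deriv (g i) v x)\<^sup>2
      + deriv \<theta> (g i x) * dir_deriv (dir_deriv (g i) v) v x)"
proof -
  let ?f = "\<lambda>x. \<Sum>i\<in>I. \<theta> (g i x)"
  let ?f' = "\<lambda>x. \<Sum>i\<in>I. deriv \<theta> (g i x) * dir_deriv (g i) v x"
  note Dg = C_on_2D[OF g(1)]
  have \<theta>: "\<theta> differentiable at (g i y)" "deriv \<theta> differentiable at (g i y)" if "i \<in> I" "y \<in> S" for i y
  proof -
    have y: "g i y \<in> T" using g(2)[OF that(1)] that(2) by blast
    show "\<theta> differentiable at (g i y)" using C_on_2D(1)[OF assms(1) y] .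
    have "C_on (Suc 1) T \<theta>" using assms(1) by (simp add: numeral_2_eq_2)
    then have "C_on 1 T (deriv \<theta>)" by (rule C_on_deriv) fact
    with y show "deriv \<theta> differentiable at (g i y)" by simp
  qed
  have f': "dir_deriv ?f v y = ?f' y" if y: "y \<in> S" for y
  proof -
    have "dir_deriv ?f v y = (\<Sum>i\<in>I. dir_deriv (\<lambda>x. \<theta> (g i x)) v y)"
      by (rule frechet_derivative_sum) (rule differentiable_compose_real[OF \<theta>(1)[OF _ y] Dg(1)[OF _ y]])
    also have "\<dots> = ?f' y"
      by (rule sum.cong[OF refl], rule frechet_derivative_compose_real[OF \<theta>(1)[OF _ y] Dg(1)[OF _ y]])
    finally show ?thesis .
  qed
  have diff': "(\<lambda>y. deriv \<theta> (g i y)) differentiable at x" if "i \<in> I" for i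
    by (rule differentiable_compose_real[OF \<theta>(2)[OF that assms(4)] Dg(1)[OF that assms(4)]])
  have f'': "(\<lambda>y. deriv \<theta> (g i y) * dir_deriv (g i) v y) differentiable at x" if "i \<in> I" for i
    by (rule differentiable_mult[OF diff'[OF that] Dg(2)[OF that assms(4)]])
  \<comment> \<open>For infinite \<open>I\<close> the sum is 0 by convention, so this case is
    trivial.\<close>
  have "?f' differentiable at x"
    by (cases "finite I") (auto intro!: differentiable_sum f'')
  then have "dir_deriv (dir_deriv ?f v) v x = dir_deriv ?f' v x"
    using frechet_derivative_transform_within_open[of ?f' x S "dir_deriv ?f v"] f' assms(3,4) by simp
  also have "\<dots> = (\<Sum>i\<in>I. dir_deriv (\<lambda>y. deriv \<theta> (g i y) * dir_deriv (g i) v y) v x)"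
    by (rule frechet_derivative_sum) (rule f'')
  also have "\<dots> = (\<Sum>i\<in>I. deriv (deriv \<theta>) (g i x) * (dir_deriv (g i) v x)\<^sup>2
      + deriv \<theta> (g i x) * dir_deriv (dir_deriv (g i) v) v x)"
  proof (rule sum.cong[OF refl])
    fix i assume i: "i \<in> I"
    show "dir_deriv (\<lambda>y. deriv \<theta> (g i y) * dir_deriv (g i) v y) v x =
      deriv (deriv \<theta>) (g i x) * (dir_deriv (g i) v x)\<^sup>2 + deriv \<theta> (g i x) * dir_deriv (dir_deriv (g i) v) v x"
      unfolding frechet_derivative_mult[OF diff'[OF i] Dg(2)[OF i assms(4)]]
        frechet_derivative_compose_real[OF \<theta>(2)[OF i assms(4)] Dg(1)[OF i assms(4)]]
      by (simp add: power2_eq_square)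
  qed
  finally show ?thesis .
qed

lemma continuous_on_grad:
  assumes "C_on 1 S f"
  shows "continuous_on S (grad f)"
proof -
  have "continuous_on S (\<lambda>x. \<Sum>b\<in>Basis. dir_deriv f b x *\<^sub>R b)"
    using assms by (intro continuous_intros) simp
  then show ?thesis
    by (rule continuous_on_eq) (use assms in \<open>simp add: grad_eq_sum\<close>)
qed

section \<open>Behaviour near the boundary of the superlevel set\<close>

text \<open>From an interior point \<open>x\<close> the segment from \<open>x0\<close> can be
  prolonged slightly to a point \<open>y\<close> of the set. Then \<open>x\<close> lies between
  \<open>x0\<close> and \<open>y\<close> with positive weight on \<open>x0\<close>, and concavity
  gives \<open>g i x > 0\<close>.\<close>

lemma interior_concave_superlevel:
  fixes g :: "'i \<Rightarrow> 'a::euclidean_space \<Rightarrow> real"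
  assumes "\<And>i. i \<in> I \<Longrightarrow> concave_on UNIV (g i)" "\<And>i. i \<in> I \<Longrightarrow> g i x0 > 0"
  shows "interior {x. \<forall>i\<in>I. g i x \<ge> 0} \<subseteq> {x. \<forall>i\<in>I. g i x > 0}"
proof (intro subsetI CollectI ballI)
  fix x i assume x: "x \<in> interior {x. \<forall>i\<in>I. g i x \<ge> 0}" and i: "i \<in> I"
  obtain e where e: "e > 0" "ball x e \<subseteq> {x. \<forall>i\<in>I. g i x \<ge> 0}"
    using x unfolding mem_interior by blast
  \<comment> \<open>This step length keeps \<open>y\<close> in the ball of radius \<open>e\<close>;
    the summand 1 covers the case \<open>x = x0\<close>.\<close>
  define s where "s = e / (norm (x - x0) + 1)"
  define y where "y = x + s *\<^sub>R (x - x0)"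
  have n: "norm (x - x0) + 1 > 0" by (simp add: add_nonneg_pos)
  then have s: "s > 0" using e(1) by (simp add: s_def)
  have "s * norm (x - x0) < e"
    using n e(1) by (simp add: s_def field_simps)
  then have "y \<in> ball x e"
    using s by (simp add: y_def dist_norm)
  with e i have y: "g i y \<ge> 0" by blast
  define t where "t = 1 / (1 + s)"
  have t: "0 < t" "t < 1" "t * (1 + s) = 1" using s by (simp_all add: t_def)
  have "(1 - t) *\<^sub>R x0 + t *\<^sub>R y = x0 + (t * (1 + s)) *\<^sub>R (x - x0)"
    by (simp add: y_def algebra_simps)
  also have "\<dots> = x" using t(3) by simp
  finally have "g i x \<ge> (1 - t) * g i x0 + t * g i y"
    using concave_onD[OF assms(1)[OF i], of t x0 y] t by simp
  moreover have "(1 - t) * g i x0 > 0" "t * g i y \<ge> 0"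
    using t y assms(2)[OF i] by simp_all
  ultimately show "g i x > 0" by linarith
qed

lemma barrier_dir_deriv_at_bot:
  fixes \<theta> :: "real \<Rightarrow> real"
  assumes g: "concave_on UNIV g" "\<And>x. g differentiable at x" "g x0 > 0"
    and \<theta>: "filterlim (deriv \<theta>) at_bot (at_right 0)"
    and X: "X \<longlonglongrightarrow> l" "\<And>j. g (X j) > 0" and l: "g l = 0"
  shows "filterlim (\<lambda>j. deriv \<theta> (g (X j)) * dir_deriv g (x0 - X j) (X j)) at_bot sequentially"
  unfolding filterlim_at_bot
proof
  fix Z :: real
  have "isCont g l" using g(2) differentiable_imp_continuous_within by blast
  then have "(\<lambda>j. g (X j)) \<longlonglongrightarrow> 0"
    using X(1) l isCont_tendsto_compose[of l g X] by simp
  then have "filterlim (\<lambda>j. g (X j)) (at_right 0) sequentially"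
    using X(2) by (intro tendsto_imp_filterlim_at_right) simp_all
  then have "filterlim (\<lambda>j. deriv \<theta> (g (X j))) at_bot sequentially"
    by (rule filterlim_compose[OF \<theta>])
  \<comment> \<open>The bound 0 fixes the sign, so that multiplying the lower bound
    \<open>g x0 / 2\<close> by \<open>deriv \<theta> (g (X j))\<close> reverses the inequality; the
    other bound is scaled so that the resulting product is at most \<open>Z\<close>.\<close>
  then have "\<forall>\<^sub>F j in sequentially. deriv \<theta> (g (X j)) \<le> min 0 (Z / (g x0 / 2))"
    unfolding filterlim_at_bot by blast
  moreover have "\<forall>\<^sub>F j in sequentially. g (X j) < g x0 / 2"
    using \<open>(\<lambda>j. g (X j)) \<longlonglongrightarrow> 0\<close> g(3) by (intro order_tendstoD(2)) auto
  ultimately show "\<forall>\<^sub>F j in sequentially. deriv \<theta> (g (X j)) * dir_deriv g (x0 - X j) (X j) \<le> Z"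
  proof eventually_elim
    case (elim j)
    have "g x0 / 2 \<le> dir_deriv g (x0 - X j) (X j)"
      using concave_below_tangent[OF g(1,2), of x0 "X j"] elim by linarith
    then have "deriv \<theta> (g (X j)) * dir_deriv g (x0 - X j) (X j) \<le> deriv \<theta> (g (X j)) * (g x0 / 2)"
      using elim by (intro mult_left_mono_neg) simp_all
    also have "\<dots> \<le> Z / (g x0 / 2) * (g x0 / 2)"
      using elim g(3) by (intro mult_right_mono) simp_all
    also have "\<dots> = Z" using g(3) by simp
    finally show ?case .
  qed
qed

text \<open>The other summands need only be eventually bounded above, so several of them may tend to
  \<open>-\<infinity>\<close> at once, as happens where several constraints are active.\<close>

lemma filterlim_sum_at_bot:
  fixes f :: "'i \<Rightarrow> 'a \<Rightarrow> real"
  assumes "finite I" "k \<in> I" "filterlim (f k) at_bot F"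
    and bdd: "\<And>i. i \<in> I \<Longrightarrow> \<exists>B. \<forall>\<^sub>F j in F. f i j \<le> B"
  shows "filterlim (\<lambda>j. \<Sum>i\<in>I. f i j) at_bot F"
  unfolding filterlim_at_bot
proof
  fix Z
  obtain B where B: "\<And>i. i \<in> I \<Longrightarrow> \<forall>\<^sub>F j in F. f i j \<le> B i"
    using bdd by metis
  then have "\<forall>\<^sub>F j in F. \<forall>i\<in>I - {k}. f i j \<le> B i"
    using assms(1) by (intro eventually_ball_finite) auto
  moreover have "\<forall>\<^sub>F j in F. f k j \<le> Z - (\<Sum>i\<in>I - {k}. B i)"
    using assms(3) unfolding filterlim_at_bot by blast
  ultimately show "\<forall>\<^sub>F j in F. (\<Sum>i\<in>I. f i j) \<le> Z"
  proof eventually_elim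
    case (elim j)
    have "(\<Sum>i\<in>I. f i j) = f k j + (\<Sum>i\<in>I - {k}. f i j)"
      using assms(1,2) by (rule sum.remove)
    also have "(\<Sum>i\<in>I - {k}. f i j) \<le> (\<Sum>i\<in>I - {k}. B i)"
      using elim(1) by (intro sum_mono) blast
    finally show ?case using elim(2) by simp
  qed
qed

text \<open>The convergent \<open>w j\<close> are eventually bounded by \<open>K\<close>, so by
  Cauchy-Schwarz an inner product below \<open>- (K * Z)\<close> forces \<open>norm (v j)\<close> to
  be at least \<open>Z\<close>.\<close>

lemma filterlim_norm_at_top_if_inner_at_bot:
  fixes v w :: "nat \<Rightarrow> 'a::real_inner"
  assumes "w \<longlonglongrightarrow> w0" "filterlim (\<lambda>j. w j \<bullet> v j) at_bot sequentially"
  shows "filterlim (\<lambda>j. norm (v j)) at_top sequentially"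
  unfolding filterlim_at_top
proof
  fix Z :: real
  define K where "K = norm w0 + 1"
  have K: "K > 0" by (simp add: K_def add_nonneg_pos)
  have "\<forall>\<^sub>F j in sequentially. norm (w j) < K"
    using tendsto_norm[OF assms(1)] by (rule order_tendstoD(2)) (simp add: K_def)
  moreover have "\<forall>\<^sub>F j in sequentially. w j \<bullet> v j \<le> - (K * Z)"
    using assms(2) unfolding filterlim_at_bot by blast
  ultimately show "\<forall>\<^sub>F j in sequentially. Z \<le> norm (v j)"
  proof eventually_elim
    case (elim j)
    have "norm (w j) * norm (v j) \<le> K * norm (v j)"
      using elim(1) by (intro mult_right_mono) simp_all
    then have "K * Z \<le> K * norm (v j)"
      using elim(2) Cauchy_Schwarz_ineq2[of "w j" "v j"] by linarith
    then show ?case using K by simp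
  qed
qed

theorem proposition4p3:
  fixes p :: nat
    and I :: "nat set"
    and g :: "nat \<Rightarrow> real ^ 'n \<Rightarrow> real"
    and x0 :: "real ^ 'n"
    and C :: "(real ^ 'n) set"
    and \<theta> :: "real \<Rightarrow> ereal"
    and \<theta>r :: "real \<Rightarrow> real"
    and h :: "real ^ 'n \<Rightarrow> ereal"
    and hr :: "real ^ 'n \<Rightarrow> real"
  assumes "p \<ge> 1" and I_eq: "I = {1..p}"
    and "\<And>i. i \<in> I \<Longrightarrow> C_on 3 UNIV (g i)"
    and "\<And>i. i \<in> I \<Longrightarrow> concave_on UNIV (g i)"
    and "\<And>i. i \<in> I \<Longrightarrow> g i x0 > 0"
    and C_eq: "C = {x. \<forall>i\<in>I. g i x > 0}"
    and "\<theta> \<in> Gamma0" and "legendre_type \<theta>"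
    and \<theta>r_eq: "\<theta>r = (\<lambda>s. real_of_ereal (\<theta> s))"
    and "{0<..} \<subseteq> eff_dom \<theta>" and "eff_dom \<theta> \<subseteq> {0..}"
    and "C_on 3 {0<..} \<theta>r" and "filterlim (deriv \<theta>r) at_bot (at_right 0)"
    and "\<And>s. s > 0 \<Longrightarrow> deriv (deriv \<theta>r) s > 0"
    and "antimono \<theta> \<or> (\<forall>i\<in>I. \<exists>a b. \<forall>x. g i x = a \<bullet> x + b)"
    and h_eq: "h = (\<lambda>x. \<Sum>i\<in>I. \<theta> (g i x))"
    and hr_eq: "hr = (\<lambda>x. real_of_ereal (h x))"
  shows "h \<in> Gamma0 \<and> essentially_smooth h \<and> interior (eff_dom h) = C \<and> C_on 3 C hr \<and>
    ((\<forall>x\<in>C. span {grad (g i) x | i. i \<in> I} = UNIV) \<longrightarrow>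
       (\<forall>x\<in>C. pos_definite (hessian hr x)) \<and>
       legendre_type h \<and> interior (eff_dom h) = C \<and>
       C_on 2 C hr \<and>
       (\<forall>x\<in>C. transpose (hessian hr x) = hessian hr x \<and> pos_definite (hessian hr x)) \<and>
       locally_lipschitz_on C (hessian hr))"
proof -
  note g_C3 = assms(3) and g_concave = assms(4) and g_x0 = assms(5) and \<theta>_Gamma0 = assms(7)
    and \<theta>r_C3 = assms(12) and \<theta>'_at_bot = assms(13) and \<theta>''_pos = assms(14) and alt = assms(15)
  have fin: "finite I" by (simp add: I_eq)
  have g_C2: "C_on 2 UNIV (g i)" and g_C1: "C_on 1 UNIV (g i)" if "i \<in> I" for i
    by (rule C_on_mono[OF g_C3[OF that]], simp)+
  note Dg = C_on_2D[OF g_C2, simplified]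
  have g_cont: "continuous_on UNIV (g i)" if "i \<in> I" for i
    using Dg(1)[OF that] differentiable_imp_continuous_within
    by (intro continuous_at_imp_continuous_on) blast
  have \<theta>_pos: "\<theta> s = ereal (\<theta>r s)" if "s > 0" for s
  proof -
    have "\<theta> s < \<infinity>" using assms(10) that by (auto simp: eff_dom_def)
    then show ?thesis
      using Gamma0D(1)[OF \<theta>_Gamma0, of s] by (cases "\<theta> s") (simp_all add: \<theta>r_eq)
  qed
  have \<theta>r_C2: "C_on 2 {0<..} \<theta>r"
    using \<theta>r_C3 by (rule C_on_mono) simp
  have C_gpos: "g i x > 0" if "i \<in> I" "x \<in> C" for i x
    using that C_eq by simp
  then have g_img: "g i ` C \<subseteq> {0<..}" if "i \<in> I" for i
    using that by auto

  \<comment> \<open>Openness and convexity of \<open>C\<close>\<close>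
  have "C = (\<Inter>i\<in>I. {x. 0 < g i x})" by (auto simp: C_eq)
  then have open_C: "open C"
    using fin g_cont by (auto intro!: open_Collect_less)
  have convex_C: "convex C"
    unfolding convex_alt
  proof (intro ballI allI impI)
    fix x y and t :: real assume x: "x \<in> C" and y: "y \<in> C" and t: "0 \<le> t \<and> t \<le> 1"
    have "0 < g i ((1 - t) *\<^sub>R x + t *\<^sub>R y)" if i: "i \<in> I" for i
    proof -
      have "0 < (1 - t) * g i x + t * g i y"
        using C_gpos[OF i x] C_gpos[OF i y] t by (cases "t = 0") (simp_all add: add_nonneg_pos)
      also have "\<dots> \<le> g i ((1 - t) *\<^sub>R x + t *\<^sub>R y)"
        using concave_onD[OF g_concave[OF i]] t by simp
      finally show ?thesis .
    qed
    then show "(1 - t) *\<^sub>R x + t *\<^sub>R y \<in> C" by (simp add: C_eq)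
  qed

  \<comment> \<open>Membership of \<open>h\<close> in \<open>Gamma0\<close>\<close>
  have "(\<lambda>x. \<theta> (g i x)) \<in> Gamma0" if i: "i \<in> I" for i
  proof (rule Gamma0_compose[OF \<theta>_Gamma0 g_cont[OF i], of x0])
    show "g i x0 \<in> eff_dom \<theta>" using assms(10) g_x0[OF i] by auto
    fix x y and t :: real assume t: "0 < t" "t < 1"
    show "\<theta> (g i ((1 - t) *\<^sub>R x + t *\<^sub>R y)) \<le> \<theta> ((1 - t) * g i x + t * g i y)"
      using alt
    proof
      assume "antimono \<theta>"
      then show ?thesis
        using concave_onD[OF g_concave[OF i], of t x y] t by (auto dest: antimonoD)
    next
      assume "\<forall>i\<in>I. \<exists>a b. \<forall>x. g i x = a \<bullet> x + b"
      then obtain a b where "\<And>x. g i x = a \<bullet> x + b" using i by blast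
      then have "g i ((1 - t) *\<^sub>R x + t *\<^sub>R y) = (1 - t) * g i x + t * g i y"
        by (simp add: algebra_simps)
      then show ?thesis by simp
    qed
  qed
  moreover have "x0 \<in> eff_dom (\<lambda>x. \<theta> (g i x))" if "i \<in> I" for i
    using \<theta>_pos[OF g_x0[OF that]] by (simp add: eff_dom_def)
  ultimately have h_Gamma0: "h \<in> Gamma0"
    unfolding h_eq using fin by (intro Gamma0_sum)

  \<comment> \<open>Effective domain, regularity and first derivative\<close>
  \<comment> \<open>\<open>f\<close> and \<open>hr\<close> agree on \<open>C\<close>, but elsewhere
    \<open>hr\<close> may be the default value 0 of \<open>real_of_ereal\<close> at
    \<open>\<infinity>\<close>. Derivatives are therefore transferred inside the open set
    \<open>C\<close>.\<close>
  define f where "f = (\<lambda>x. \<Sum>i\<in>I. \<theta>r (g i x))"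
  have h_C: "h x = ereal (f x)" if "x \<in> C" for x
    using \<theta>_pos C_gpos that by (simp add: h_eq f_def)
  then have hr_C: "hr x = f x" if "x \<in> C" for x
    using that by (simp add: hr_eq)
  \<comment> \<open>Whether boundary points belong to \<open>eff_dom h\<close> depends on
    \<open>\<theta> 0\<close> being finite. Enclosing the domain between \<open>C\<close> and this
    closed set settles its interior in both cases.\<close>
  have dom_h: "eff_dom h \<subseteq> {x. \<forall>i\<in>I. g i x \<ge> 0}"
  proof (intro subsetI CollectI ballI)
    fix x i assume "x \<in> eff_dom h" and i: "i \<in> I"
    then have "h x \<noteq> \<infinity>" by (auto simp: eff_dom_def)
    then have "\<theta> (g i x) \<noteq> \<infinity>"
      using fin i unfolding h_eq sum_Pinfty by blast
    then have "g i x \<in> eff_dom \<theta>" by (simp add: eff_dom_def)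
    then show "g i x \<ge> 0" using assms(11) by auto
  qed
  have "C \<subseteq> eff_dom h" by (auto simp: eff_dom_def h_C)
  moreover have "interior {x. \<forall>i\<in>I. g i x \<ge> 0} \<subseteq> C"
    unfolding C_eq by (rule interior_concave_superlevel[OF g_concave g_x0])
  then have "interior (eff_dom h) \<subseteq> C"
    using interior_mono[OF dom_h] by (rule order_trans[rotated])
  ultimately have int_dom: "interior (eff_dom h) = C"
    using open_C interior_maximal by blast

  have "C_on 3 C f"
    unfolding f_def
    using C_on_subset[OF g_C3] g_img
    by (intro C_on_sum fin open_C C_on_compose[OF _ _ _ \<theta>r_C3]) auto
  then have hr_C3: "C_on 3 C hr"
    by (rule C_on_cong[OF _ open_C]) (simp add: hr_C)
  then have hr_C2: "C_on 2 C hr"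
    by (rule C_on_mono) simp
  note Dhr = C_on_2D[OF hr_C2]

  have \<theta>r_diff: "\<theta>r differentiable at s" if "s > 0" for s
    using C_on_2D(1)[OF \<theta>r_C2] that by simp
  have dir_hr: "dir_deriv hr v x = (\<Sum>i\<in>I. deriv \<theta>r (g i x) * dir_deriv (g i) v x)" if x: "x \<in> C" for v x
  proof -
    have "dir_deriv hr v x = dir_deriv f v x"
      using frechet_derivative_transform_within_open[OF Dhr(1)[OF x] open_C x hr_C] by simp
    also have "\<dots> = (\<Sum>i\<in>I. dir_deriv (\<lambda>x. \<theta>r (g i x)) v x)"
      unfolding f_def
      by (rule frechet_derivative_sum) (rule differentiable_compose_real[OF \<theta>r_diff[OF C_gpos[OF _ x]] Dg(1)])
    also have "\<dots> = (\<Sum>i\<in>I. deriv \<theta>r (g i x) * dir_deriv (g i) v x)"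
      by (rule sum.cong[OF refl], rule frechet_derivative_compose_real[OF \<theta>r_diff[OF C_gpos[OF _ x]] Dg(1)])
    finally show ?thesis .
  qed

  \<comment> \<open>Blow-up of the gradient at the boundary\<close>
  have "essentially_smooth h"
    unfolding essentially_smooth_def int_dom hr_eq[symmetric]
  proof (intro conjI allI impI h_Gamma0)
    show "hr differentiable_on C"
      using Dhr(1) by (simp add: differentiable_at_imp_differentiable_on)
    fix X l assume "(\<forall>j. X j \<in> C) \<and> l \<in> frontier (eff_dom h) \<and> X \<longlonglongrightarrow> l"
    then have X: "\<And>j. X j \<in> C" "X \<longlonglongrightarrow> l" and l: "l \<in> frontier (eff_dom h)" by auto
    have "{x. \<forall>i\<in>I. g i x \<ge> 0} = (\<Inter>i\<in>I. {x. 0 \<le> g i x})" by auto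
    then have "closed {x. \<forall>i\<in>I. g i x \<ge> 0}"
      using g_cont by (auto intro!: closed_Collect_le)
    then have "l \<in> {x. \<forall>i\<in>I. g i x \<ge> 0}"
      using l dom_h closure_minimal unfolding frontier_def by blast
    moreover have "l \<notin> C" using l int_dom by (simp add: frontier_def)
    ultimately obtain k where k: "k \<in> I" "g k l = 0"
      unfolding C_eq by force
    \<comment> \<open>By \<open>dir_hr\<close>, \<open>?T i j\<close> is the share of index
      \<open>i\<close> in the inner product of \<open>x0 - X j\<close> with the gradient of
      \<open>hr\<close> at \<open>X j\<close>.\<close>
    let ?T = "\<lambda>i j. deriv \<theta>r (g i (X j)) * dir_deriv (g i) (x0 - X j) (X j)"
    have at_bot: "filterlim (?T i) at_bot sequentially" if "i \<in> I" "g i l = 0" for i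
      using that X by (intro barrier_dir_deriv_at_bot g_concave Dg g_x0 \<theta>'_at_bot C_gpos)
    have "\<exists>B. \<forall>\<^sub>F j in sequentially. ?T i j \<le> B" if i: "i \<in> I" for i
    proof (cases "g i l = 0")
      case True
      then show ?thesis using at_bot[OF i] unfolding filterlim_at_bot by blast
    next
      case False
      then have pos: "g i l > 0" using \<open>l \<in> {x. \<forall>i\<in>I. g i x \<ge> 0}\<close> i by force
      have "C_on 2 {0<..} (deriv \<theta>r)"
        using \<theta>r_C3 by (intro C_on_deriv) (simp_all add: eval_nat_numeral)
      from C_on_2D(1)[OF this, of "g i l"] pos have "isCont (deriv \<theta>r) (g i l)"
        by (simp add: differentiable_imp_continuous_within)
      moreover have "(\<lambda>j. g i (X j)) \<longlonglongrightarrow> g i l"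
        using g_cont[OF i] X(2) by (auto intro: isCont_tendsto_compose simp: continuous_on_eq_continuous_at)
      ultimately have 1: "(\<lambda>j. deriv \<theta>r (g i (X j))) \<longlonglongrightarrow> deriv \<theta>r (g i l)"
        by (rule isCont_tendsto_compose)
      \<comment> \<open>Direction and base point both move with \<open>j\<close>; writing the
        directional derivative as an inner product with the gradient separates the two
        limits.\<close>
      have "(\<lambda>j. grad (g i) (X j)) \<longlonglongrightarrow> grad (g i) l"
        using continuous_on_grad[OF g_C1[OF i]] X(2)
        by (auto intro: isCont_tendsto_compose simp: continuous_on_eq_continuous_at)
      then have "(\<lambda>j. (x0 - X j) \<bullet> grad (g i) (X j)) \<longlonglongrightarrow> (x0 - l) \<bullet> grad (g i) l"
        by (intro tendsto_intros X)
      then have "?T i \<longlonglongrightarrow> deriv \<theta>r (g i l) * ((x0 - l) \<bullet> grad (g i) l)"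
        unfolding inner_grad[OF Dg(1)[OF i]] by (intro tendsto_mult 1)
      then have "\<forall>\<^sub>F j in sequentially. ?T i j < deriv \<theta>r (g i l) * ((x0 - l) \<bullet> grad (g i) l) + 1"
        by (rule order_tendstoD(2)) simp
      then show ?thesis by (intro exI, elim eventually_mono) (rule less_imp_le)
    qed
    then have "filterlim (\<lambda>j. \<Sum>i\<in>I. ?T i j) at_bot sequentially"
      by (rule filterlim_sum_at_bot[where f = ?T, OF fin k(1) at_bot[OF k]])
    then have "filterlim (\<lambda>j. (x0 - X j) \<bullet> grad hr (X j)) at_bot sequentially"
      using X(1) by (simp add: inner_grad Dhr dir_hr)
    then show "filterlim (\<lambda>j. norm (grad hr (X j))) at_top sequentially"
      by (rule filterlim_norm_at_top_if_inner_at_bot[OF tendsto_diff[OF tendsto_const X(2)]])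
  qed

  \<comment> \<open>Positive definiteness of the Hessian\<close>
  have curvature: "deriv \<theta>r s * dir_deriv (dir_deriv (g i) v) v x \<ge> 0" if i: "i \<in> I" and s: "s > 0" for i s v x
    using alt
  proof
    assume anti: "antimono \<theta>"
    \<comment> \<open>A positive derivative would make \<open>\<theta>r\<close> strictly larger just
      to the right of \<open>s\<close>, where \<open>\<theta>\<close> is still finite, against
      monotonicity.\<close>
    have "deriv \<theta>r s \<le> 0"
    proof (rule ccontr)
      assume "\<not> ?thesis"
      then have "0 < deriv \<theta>r s" by simp
      moreover have "DERIV \<theta>r s :> deriv \<theta>r s"
        using \<theta>r_diff[OF s] by (simp add: DERIV_deriv_iff_real_differentiable)
      ultimately obtain d where d: "d > 0" "\<And>h. 0 < h \<Longrightarrow> h < d \<Longrightarrow> \<theta>r s < \<theta>r (s + h)"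
        using DERIV_pos_inc_right by blast
      have "\<theta> (s + d / 2) \<le> \<theta> s" using anti d(1) by (simp add: antimonoD)
      then have "\<theta>r (s + d / 2) \<le> \<theta>r s" using s d(1) by (simp add: \<theta>_pos)
      with d(2)[of "d / 2"] d(1) show False by simp
    qed
    then show ?thesis
      using concave_second_dir_deriv_nonpos[OF g_concave[OF i] g_C2[OF i]] by (simp add: mult_nonpos_nonpos)
  next
    assume "\<forall>i\<in>I. \<exists>a b. \<forall>x. g i x = a \<bullet> x + b"
    then obtain a b where "\<And>x. g i x = a \<bullet> x + b" using i by blast
    \<comment> \<open>An affine function has constant directional derivatives, so the second
      derivative vanishes and the sign of \<open>deriv \<theta>r s\<close> does not matter.\<close>
    then have "g i = (\<lambda>x. a \<bullet> x + b)" by blast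
    then have "(g i has_derivative (\<lambda>v. a \<bullet> v)) (at y)" for y
      by (auto intro!: derivative_eq_intros)
    from frechet_derivative_at[OF this] have "dir_deriv (g i) v = (\<lambda>y. a \<bullet> v)"
      by metis
    then show ?thesis by simp
  qed

  have dir2_hr: "dir_deriv (dir_deriv hr v) v x > 0"
    if x: "x \<in> C" and "v \<noteq> 0" and span: "span {grad (g i) x | i. i \<in> I} = UNIV" for v x
  proof -
    let ?t = "\<lambda>i. deriv (deriv \<theta>r) (g i x) * (dir_deriv (g i) v x)\<^sup>2
      + deriv \<theta>r (g i x) * dir_deriv (dir_deriv (g i) v) v x"
    \<comment> \<open>Otherwise \<open>v\<close> would be orthogonal to all gradients, hence to
      their span, hence to itself.\<close>
    have "\<exists>k\<in>I. dir_deriv (g k) v x \<noteq> 0"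
    proof (rule ccontr)
      assume "\<not> ?thesis"
      then have "orthogonal v y" if "y \<in> {grad (g i) x | i. i \<in> I}" for y
        using that inner_grad[OF Dg(1)] by (auto simp: orthogonal_def)
      then have "orthogonal v v"
        using orthogonal_to_span[of v "{grad (g i) x | i. i \<in> I}" v] span by auto
      with \<open>v \<noteq> 0\<close> show False by (simp add: orthogonal_def)
    qed
    then obtain k where k: "k \<in> I" "dir_deriv (g k) v x \<noteq> 0" by blast
    \<comment> \<open>Two transfers are needed: the first derivatives of \<open>hr\<close> and
      \<open>f\<close> agree on all of the open set \<open>C\<close>, and therefore so do their
      derivatives at \<open>x\<close>.\<close>
    have "dir_deriv (dir_deriv hr v) v x = dir_deriv (dir_deriv f v) v x"
      using frechet_derivative_transform_within_open[OF Dhr(2)[OF x] open_C x]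
        frechet_derivative_transform_within_open[OF Dhr(1) open_C _ hr_C] by metis
    also have "\<dots> = (\<Sum>i\<in>I. ?t i)"
      unfolding f_def using C_on_subset[OF g_C2] g_img
      by (intro second_dir_deriv_compose_sum[OF \<theta>r_C2 _ open_C x]) auto
    also have "\<dots> > 0"
    proof (rule sum_pos2[OF fin k(1)])
      show "0 < ?t k"
        using \<theta>''_pos[OF C_gpos[OF k(1) x]] k(2) curvature[OF k(1) C_gpos[OF k(1) x]]
        by (intro add_pos_nonneg) simp_all
      show "0 \<le> ?t i" if "i \<in> I" for i
        using \<theta>''_pos[OF C_gpos[OF that x]] curvature[OF that C_gpos[OF that x]]
        by (intro add_nonneg_nonneg) simp_all
    qed
    finally show ?thesis .
  qed

  have "pos_definite (hessian hr x)" if "\<forall>x\<in>C. span {grad (g i) x | i. i \<in> I} = UNIV" "x \<in> C" for x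
    unfolding pos_definite_def inner_hessian[OF hr_C2 open_C that(2)] using dir2_hr that by blast
  moreover have "legendre_type h" if "\<forall>x\<in>C. span {grad (g i) x | i. i \<in> I} = UNIV"
    unfolding legendre_type_def int_dom hr_eq[symmetric]
    using \<open>essentially_smooth h\<close> dir2_hr that
    by (intro conjI strictly_convex_on_if_second_dir_deriv_pos[OF hr_C2 convex_C]) blast+
  ultimately show ?thesis
    using h_Gamma0 \<open>essentially_smooth h\<close> int_dom hr_C3 hr_C2
      transpose_hessian[OF hr_C2 open_C] hessian_locally_lipschitz[OF hr_C3 open_C]
    by blast
qed

end
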